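(* For any $n\ge 3$ and any $d$, we have $\mathrm{dmg}((K_n)^d)=n^{d-1}$.
   Context: Graphs are finite and simple. $n$ and $d$ are positive integers, $K_n$ is the complete graph on $n$ vertices, and $(K_n)^d$ is the Cartesian product of $d$ copies of $K_n$ (vertices are $d$-tuples, two being adjacent iff they differ in exactly one coordinate). Damage number. One cop and one robber play on a graph $G$ with perfect information. First the cop chooses a starting vertex, then the robber chooses a starting vertex (this placement is round $0$). Each subsequent round consists of a move of the cop followed by a move of the robber; in a move a player either stays at the current vertex or moves to a neighboring vertex. If the cop ever occupies the same vertex as the robber, the robber is captured and the game ends. If a vertex $v$ is occupied by the robber at the end of a round and the robber is not caught in the following round, then $v$ becomes damaged and stays damaged for the rest of the game. The cop wants to minimize, and the robber to maximize, the number of damaged vertices. The damage number $\mathrm{dmg}(G)$ is the number of damaged vertices when both play optimally, i.e. the maximum number of vertices the robber can guarantee to damage no matter the strategy of the cop.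
   Formalization: The formal theorem assumes d ≥ 2: for d = 1 the claim is false, since on K_n the cop captures the robber in round 1 before any vertex is damaged, so dmg(K_n) = 0 while n^(d-1) = 1. *)

theory Defs
  imports "Graph_Theory.Graph_Theory"
begin

section \<open>Cartesian powers of graphs\<close>

text \<open>
  A finite simple graph is a \<^locale>\<open>pair_graph\<close>: a finite vertex set with a symmetric,
  irreflexive arc relation.  The vertices of the \<open>d\<close>-th Cartesian power are the \<open>d\<close>-tuples,
  represented as lists of length \<open>d\<close>.
\<close>

definition cart_power :: "'a pair_pre_digraph \<Rightarrow> nat \<Rightarrow> 'a list pair_pre_digraph" where
  "cart_power G d =
     (let V = {xs. length xs = d \<and> set xs \<subseteq> pverts G} in
      \<lparr> pverts = V,
        parcs = {(xs, ys). xs \<in> V \<and> ys \<in> V \<and>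
                   (\<exists>i<d. (xs ! i, ys ! i) \<in> parcs G \<and> (\<forall>j<d. j \<noteq> i \<longrightarrow> xs ! j = ys ! j))} \<rparr>)"

lemma pverts_cart_power:
  "pverts (cart_power G d) = {xs. length xs = d \<and> set xs \<subseteq> pverts G}"
  by (simp add: cart_power_def Let_def)

lemma pair_graph_cart_power:
  assumes "pair_graph G"
  shows "pair_graph (cart_power G d)"
proof -
  interpret pair_graph G by fact
  have fin: "finite (pverts (cart_power G d))"
    using finite_lists_length_eq[OF pair_finite_verts, of d]
    by (simp add: pverts_cart_power conj_commute)
  have sub: "parcs (cart_power G d) \<subseteq> pverts (cart_power G d) \<times> pverts (cart_power G d)"
    by (auto simp: cart_power_def Let_def)
  have irr: "(xs, xs) \<notin> parcs (cart_power G d)" for xs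
    by (auto simp: cart_power_def Let_def dest: pair_no_loops)
  have sy: "(ys, xs) \<in> parcs (cart_power G d)" if "(xs, ys) \<in> parcs (cart_power G d)" for xs ys
  proof -
    have flip: "(b, a) \<in> parcs G" if "(a, b) \<in> parcs G" for a b
      using that pair_sym_arcs by (simp add: symmetric_def sym_def)
    have "\<exists>i<d. (xs ! i, ys ! i) \<in> parcs G \<and> (\<forall>j<d. j \<noteq> i \<longrightarrow> xs ! j = ys ! j)"
      using that by (simp add: cart_power_def Let_def)
    then obtain i where i: "i < d" "(xs ! i, ys ! i) \<in> parcs G"
      and eq: "\<forall>j<d. j \<noteq> i \<longrightarrow> xs ! j = ys ! j"
      by blast
    have "\<forall>j<d. j \<noteq> i \<longrightarrow> ys ! j = xs ! j" using eq by metis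
    then have "\<exists>i<d. (ys ! i, xs ! i) \<in> parcs G \<and> (\<forall>j<d. j \<noteq> i \<longrightarrow> ys ! j = xs ! j)"
      using i flip by blast
    then show ?thesis
      using that by (simp add: cart_power_def Let_def)
  qed
  show ?thesis
  proof unfold_locales
    show "finite (parcs (cart_power G d))"
      using finite_subset[OF sub] fin by blast
    show "symmetric (with_proj (cart_power G d))"
      using sy by (simp add: symmetric_def sym_def)
  qed (use fin sub irr in auto)
qed

lemma cart_power_complete_adj:
  assumes "complete_digraph n (with_proj K)"
    and "xs \<in> pverts (cart_power K d)" and "ys \<in> pverts (cart_power K d)"
  shows "(xs, ys) \<in> parcs (cart_power K d) \<longleftrightarrow> (\<exists>!i. i < d \<and> xs ! i \<noteq> ys ! i)"
proof -
  have "(xs ! i, ys ! i) \<in> parcs K \<longleftrightarrow> xs ! i \<noteq> ys ! i" if "i < d" for i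
    using assms that nth_mem[of i xs] nth_mem[of i ys]
    unfolding complete_digraph_pair_def by (auto simp: pverts_cart_power)
  moreover have "(xs, ys) \<in> parcs (cart_power K d) \<longleftrightarrow>
      (\<exists>i<d. (xs ! i, ys ! i) \<in> parcs K \<and> (\<forall>j<d. j \<noteq> i \<longrightarrow> xs ! j = ys ! j))"
    using assms(2,3) by (simp add: cart_power_def Let_def)
  ultimately show ?thesis by metis
qed


section \<open>The damage game\<close>

text \<open>
  A history lists the pairs (position of the cop, position of the robber) at the ends of the
  rounds \<open>0, 1, \<dots>\<close> played so far, in chronological order.  The cop sees the history;
  the robber sees the history and, in addition, the cop's new position in the current round.
  On the empty history both choose their starting vertices.
\<close>

type_synonym 'v history = "('v \<times> 'v) list"

definition moves :: "'v pair_pre_digraph \<Rightarrow> 'v \<Rightarrow> 'v set" where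
  "moves G u = {v \<in> pverts G. v = u \<or> (u, v) \<in> parcs G}"

definition cop_strategy :: "'v pair_pre_digraph \<Rightarrow> ('v history \<Rightarrow> 'v) \<Rightarrow> bool" where
  "cop_strategy G \<sigma> \<longleftrightarrow>
     \<sigma> [] \<in> pverts G \<and>
     (\<forall>h. \<forall>c\<in>pverts G. \<forall>r\<in>pverts G. \<sigma> (h @ [(c, r)]) \<in> moves G c)"

definition robber_strategy :: "'v pair_pre_digraph \<Rightarrow> ('v history \<Rightarrow> 'v \<Rightarrow> 'v) \<Rightarrow> bool" where
  "robber_strategy G \<rho> \<longleftrightarrow>
     (\<forall>c\<in>pverts G. \<rho> [] c \<in> pverts G) \<and>
     (\<forall>h. \<forall>c\<in>pverts G. \<forall>r\<in>pverts G. \<forall>c'\<in>moves G c. \<rho> (h @ [(c, r)]) c' \<in> moves G r)"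

fun play :: "('v history \<Rightarrow> 'v) \<Rightarrow> ('v history \<Rightarrow> 'v \<Rightarrow> 'v) \<Rightarrow> nat \<Rightarrow> 'v history" where
  "play \<sigma> \<rho> 0 = []"
| "play \<sigma> \<rho> (Suc t) =
     (let h = play \<sigma> \<rho> t; c = \<sigma> h; r = \<rho> h c in h @ [(c, r)])"

definition cop_at :: "('v history \<Rightarrow> 'v) \<Rightarrow> ('v history \<Rightarrow> 'v \<Rightarrow> 'v) \<Rightarrow> nat \<Rightarrow> 'v" where
  "cop_at \<sigma> \<rho> t = fst (last (play \<sigma> \<rho> (Suc t)))"

definition robber_at :: "('v history \<Rightarrow> 'v) \<Rightarrow> ('v history \<Rightarrow> 'v \<Rightarrow> 'v) \<Rightarrow> nat \<Rightarrow> 'v" where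
  "robber_at \<sigma> \<rho> t = snd (last (play \<sigma> \<rho> (Suc t)))"

text \<open>
  A round contains two occasions for a capture: the cop moves onto the robber's current vertex,
  or the robber moves onto (in round 0, starts at) the vertex of the cop.  Plays are formally
  infinite, but what happens after a capture is irrelevant: \<open>captured_by\<close> is monotone in \<open>t\<close>,
  and damage in round \<open>t\<close> requires that there is no capture up to and including
  round \<open>t + 1\<close>.
\<close>

definition captured_by :: "('v history \<Rightarrow> 'v) \<Rightarrow> ('v history \<Rightarrow> 'v \<Rightarrow> 'v) \<Rightarrow> nat \<Rightarrow> bool" where
  "captured_by \<sigma> \<rho> t \<longleftrightarrow>
     (\<exists>s\<le>t. cop_at \<sigma> \<rho> s = robber_at \<sigma> \<rho> s) \<or>
     (\<exists>s<t. cop_at \<sigma> \<rho> (Suc s) = robber_at \<sigma> \<rho> s)"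

definition damaged :: "('v history \<Rightarrow> 'v) \<Rightarrow> ('v history \<Rightarrow> 'v \<Rightarrow> 'v) \<Rightarrow> 'v set" where
  "damaged \<sigma> \<rho> = {v. \<exists>t. robber_at \<sigma> \<rho> t = v \<and> \<not> captured_by \<sigma> \<rho> (Suc t)}"

definition robber_guarantees :: "'v pair_pre_digraph \<Rightarrow> nat \<Rightarrow> bool" where
  "robber_guarantees G k \<longleftrightarrow>
     (\<exists>\<rho>. robber_strategy G \<rho> \<and> (\<forall>\<sigma>. cop_strategy G \<sigma> \<longrightarrow> k \<le> card (damaged \<sigma> \<rho>)))"

text \<open>
  For a finite nonempty \<open>G\<close> the set below is finite and contains \<open>0\<close>, so its maximum exists.
\<close>

definition dmg :: "'v pair_pre_digraph \<Rightarrow> nat" where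
  "dmg G = Max {k. robber_guarantees G k}"

lemma play_in_pverts:
  assumes "cop_strategy G \<sigma>" and "robber_strategy G \<rho>"
  shows "cop_at \<sigma> \<rho> t \<in> pverts G \<and> robber_at \<sigma> \<rho> t \<in> pverts G"
proof (induction t)
  case 0
  then show ?case
    using assms by (auto simp: cop_at_def robber_at_def cop_strategy_def robber_strategy_def Let_def)
next
  case (Suc t)
  define h where "h = play \<sigma> \<rho> t"
  have p: "play \<sigma> \<rho> (Suc t) = h @ [(cop_at \<sigma> \<rho> t, robber_at \<sigma> \<rho> t)]"
    by (simp add: cop_at_def robber_at_def h_def Let_def)
  have c: "\<sigma> (play \<sigma> \<rho> (Suc t)) \<in> moves G (cop_at \<sigma> \<rho> t)"
    using assms(1) Suc unfolding p cop_strategy_def by blast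
  have "\<rho> (play \<sigma> \<rho> (Suc t)) (\<sigma> (play \<sigma> \<rho> (Suc t))) \<in> moves G (robber_at \<sigma> \<rho> t)"
    using assms(2) Suc c unfolding p robber_strategy_def by blast
  moreover have "cop_at \<sigma> \<rho> (Suc t) = \<sigma> (play \<sigma> \<rho> (Suc t))"
    "robber_at \<sigma> \<rho> (Suc t) = \<rho> (play \<sigma> \<rho> (Suc t)) (\<sigma> (play \<sigma> \<rho> (Suc t)))"
    by (simp_all add: cop_at_def robber_at_def Let_def)
  ultimately show ?case using c by (simp add: moves_def)
qed

lemma dmg_set:
  assumes "finite (pverts G)" and "pverts G \<noteq> {}"
  shows "robber_guarantees G 0" and "finite {k. robber_guarantees G k}"
proof -
  obtain v where v: "v \<in> pverts G" using assms(2) by blast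
  define \<rho> :: "('a \<times> 'a) list \<Rightarrow> 'a \<Rightarrow> 'a" where "\<rho> = (\<lambda>h c. if h = [] then v else snd (last h))"
  have "robber_strategy G \<rho>" using v by (auto simp: robber_strategy_def \<rho>_def moves_def)
  then show "robber_guarantees G 0" unfolding robber_guarantees_def by blast
  define \<sigma> :: "('a \<times> 'a) list \<Rightarrow> 'a" where "\<sigma> = (\<lambda>h. if h = [] then v else fst (last h))"
  have s: "cop_strategy G \<sigma>" using v by (auto simp: cop_strategy_def \<sigma>_def moves_def)
  have "k \<le> card (pverts G)" if g: "robber_guarantees G k" for k
  proof -
    obtain \<tau> where r: "robber_strategy G \<tau>" and "k \<le> card (damaged \<sigma> \<tau>)"
      using g s unfolding robber_guarantees_def by blast
    moreover have "damaged \<sigma> \<tau> \<subseteq> pverts G"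
      using play_in_pverts[OF s r] by (auto simp: damaged_def)
    ultimately show ?thesis using card_mono[OF assms(1)] order_trans by blast
  qed
  then show "finite {k. robber_guarantees G k}"
    by (metis (mono_tags, lifting) finite_nat_set_iff_bounded_le mem_Collect_eq)
qed

text \<open>
  On a complete graph the cop captures the robber in round 1 at the latest, before any vertex is
  damaged.  Hence the formula \<open>dmg ((K_n)^d) = n ^ (d - 1)\<close> fails for \<open>d = 1\<close>, where the
  left-hand side is \<open>0\<close> and the right-hand side is \<open>1\<close>.
\<close>

lemma dmg_cart_power_complete_1:
  assumes K: "complete_digraph n (with_proj K)" and n: "n \<ge> 1"
  shows "dmg (cart_power K 1) = 0"
proof -
  let ?G = "cart_power K 1"
  have fin: "finite (pverts ?G)"
    using K finite_lists_length_eq[of "pverts K" 1]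
    unfolding complete_digraph_pair_def by (simp add: pverts_cart_power conj_commute)
  obtain x where "x \<in> pverts K"
    using K n unfolding complete_digraph_pair_def by (metis card.empty ex_in_conv not_one_le_zero)
  then have v: "[x] \<in> pverts ?G" by (simp add: pverts_cart_power)
  have all: "r \<in> moves ?G c" if "c \<in> pverts ?G" "r \<in> pverts ?G" for c r
    using that K unfolding complete_digraph_pair_def
    by (auto simp: moves_def cart_power_def Let_def length_Suc_conv)
  define \<sigma> :: "('a list \<times> 'a list) list \<Rightarrow> 'a list"
    where "\<sigma> = (\<lambda>h. if h = [] then [x] else snd (last h))"
  have s: "cop_strategy ?G \<sigma>" using v all by (auto simp: cop_strategy_def \<sigma>_def)
  have "k = 0" if g: "robber_guarantees ?G k" for k
  proof -
    obtain \<rho> where k: "k \<le> card (damaged \<sigma> \<rho>)"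
      using g s unfolding robber_guarantees_def by blast
    have "captured_by \<sigma> \<rho> (Suc t)" for t
      unfolding captured_by_def
      by (rule disjI2, rule exI[of _ 0]) (simp add: cop_at_def robber_at_def \<sigma>_def Let_def)
    then show ?thesis using k by (simp add: damaged_def)
  qed
  moreover have "robber_guarantees ?G 0" using dmg_set(1) fin v by blast
  ultimately have "{k. robber_guarantees ?G k} = {0}" by blast
  then show ?thesis by (simp add: dmg_def)
qed

end

theory Submission
  imports Defs "HOL-Combinatorics.Transposition"
begin

text \<open>
  The value is \<open>n ^ (d - 1)\<close>, the size of a coordinate hyperplane, for two independent reasons.

  \<^emph>\<open>The cop can confine the robber's damage to a hyperplane.\<close>  The cop mirrors: whenever the
  robber changes a coordinate, the cop sets the same coordinate to the robber's new value, and
  otherwise the cop waits.  Hence every coordinate the robber has ever changed agrees with the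
  cop's after the cop's reply, and as long as the robber is not captured some coordinate still
  has the robber's initial value.  The set of such coordinates only shrinks with time, so one and
  the same coordinate serves all damaged vertices (\<open>damaged_mirror_subset_hyperplane\<close>).

  \<^emph>\<open>The robber can win every race he starts ahead in.\<close>  If it is the robber's turn and he is
  strictly closer than the cop to a vertex \<open>u\<close>, he walks to \<open>u\<close> on a shortest path; by the triangle
  inequality the cop can neither intercept him on the way nor capture him on arrival.  So in any
  graph without a dominating vertex he damages at least \<open>k\<close> vertices provided that for any two
  distinct positions \<open>c\<close> and \<open>r\<close> at least \<open>k\<close> vertices are strictly closer to \<open>r\<close> than to \<open>c\<close>:
  among them there is always an undamaged one while fewer than \<open>k\<close> are damaged
  (\<open>robber_guarantees_if_many_closer\<close>).

  For words of length \<open>d\<close> over \<open>n\<close> letters and the Hamming distance, that number is at least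
  \<open>n ^ (d - 1)\<close>.  Choose a coordinate in which \<open>c\<close> and \<open>r\<close> differ.  As \<open>n \<ge> 3\<close>, each of the
  \<open>n ^ (d - 1)\<close> lines in that direction contains at least two points not equidistant from \<open>c\<close>
  and \<open>r\<close>, so there are at least \<open>2 * n ^ (d - 1)\<close> such points altogether, and exchanging the
  letters of \<open>c\<close> and \<open>r\<close> in every coordinate shows that half of them are closer to \<open>r\<close>
  (\<open>card_closer_ge\<close>).
\<close>

section \<open>Plays as sequences of positions\<close>

lemma play_eq_map: "play \<sigma> \<rho> t = map (\<lambda>s. (cop_at \<sigma> \<rho> s, robber_at \<sigma> \<rho> s)) [0..<t]"
  by (induction t) (simp_all add: cop_at_def robber_at_def Let_def)

lemma robber_at_0: "robber_at \<sigma> \<rho> 0 = \<rho> [] (cop_at \<sigma> \<rho> 0)"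
  by (simp add: cop_at_def robber_at_def Let_def)

lemma cop_at_Suc: "cop_at \<sigma> \<rho> (Suc t) = \<sigma> (play \<sigma> \<rho> (Suc t))"
  by (simp add: cop_at_def Let_def)

lemma robber_at_Suc: "robber_at \<sigma> \<rho> (Suc t) = \<rho> (play \<sigma> \<rho> (Suc t)) (cop_at \<sigma> \<rho> (Suc t))"
  by (simp add: cop_at_def robber_at_def Let_def)

lemma last_play: "last (play \<sigma> \<rho> (Suc t)) = (cop_at \<sigma> \<rho> t, robber_at \<sigma> \<rho> t)"
  unfolding play_eq_map by simp

lemma play_Suc_snoc: "play \<sigma> \<rho> (Suc t) = play \<sigma> \<rho> t @ [(cop_at \<sigma> \<rho> t, robber_at \<sigma> \<rho> t)]"
  unfolding play_eq_map by simp

lemma cop_at_moves: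
  assumes "cop_strategy G \<sigma>" and "robber_strategy G \<rho>"
  shows "cop_at \<sigma> \<rho> (Suc t) \<in> moves G (cop_at \<sigma> \<rho> t)"
  using assms play_in_pverts[OF assms, of t]
  unfolding cop_at_Suc play_Suc_snoc[of \<sigma> \<rho> t] cop_strategy_def by blast

lemma robber_at_moves:
  assumes "cop_strategy G \<sigma>" and "robber_strategy G \<rho>"
  shows "robber_at \<sigma> \<rho> (Suc t) \<in> moves G (robber_at \<sigma> \<rho> t)"
  using assms play_in_pverts[OF assms, of t] cop_at_moves[OF assms, of t]
  unfolding robber_at_Suc play_Suc_snoc[of \<sigma> \<rho> t] robber_strategy_def by blast


section \<open>Racing to undamaged vertices\<close>

text \<open>
  The robber always heads for a nearest one among the unvisited vertices that are strictly closer
  to him than to the cop.  The distance to that target drops with each of his moves, since the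
  old target stays eligible after any reply of the cop; so he visits new vertices again and again
  until no eligible vertex remains, which by \<open>many\<close> needs \<open>k\<close> visited vertices.  Visited vertices
  are damaged since he never ends a round within the cop's reach as long as he has a target.  All
  that matters about the distance \<open>\<delta>\<close> is that one move lowers it by at most one and that a
  suitable move does lower it.
\<close>

lemma robber_guarantees_if_many_closer:
  fixes G :: "'v pair_pre_digraph" and \<delta> :: "'v \<Rightarrow> 'v \<Rightarrow> nat"
  assumes fin: "finite (pverts G)"
    and lip: "\<And>x y u. \<lbrakk>x \<in> pverts G; u \<in> pverts G; y \<in> moves G x\<rbrakk> \<Longrightarrow> \<delta> x u \<le> Suc (\<delta> y u)"
    and step: "\<And>x u. \<lbrakk>x \<in> pverts G; u \<in> pverts G; x \<noteq> u\<rbrakk> \<Longrightarrow> \<exists>y\<in>moves G x. \<delta> y u < \<delta> x u"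
    and start: "\<And>c. c \<in> pverts G \<Longrightarrow> \<exists>r\<in>pverts G. r \<notin> moves G c"
    and many: "\<And>c r. \<lbrakk>c \<in> pverts G; r \<in> pverts G; c \<noteq> r\<rbrakk>
                 \<Longrightarrow> k \<le> card {u \<in> pverts G. \<delta> r u < \<delta> c u}"
  shows "robber_guarantees G k"
proof -
  define eligible where
    "eligible S c r u \<longleftrightarrow> u \<in> pverts G \<and> u \<notin> S \<and> \<delta> r u < \<delta> c u" for S c r u
  define target where "target S c r = arg_min (\<delta> r) (eligible S c r)" for S c r
  have target: "eligible S c r (target S c r)" and target_le: "\<delta> r (target S c r) \<le> \<delta> r u"
    if "eligible S c r u" for S c r u
    using arg_min_nat_lemma[of "eligible S c r" u "\<delta> r"] that unfolding target_def by blast+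
  define \<rho> :: "'v history \<Rightarrow> 'v \<Rightarrow> 'v" where "\<rho> h c =
     (if h = [] then SOME r. r \<in> pverts G \<and> r \<notin> moves G c
      else let r = snd (last h); S = snd ` set h in
        if \<exists>u. eligible S c r u
        then SOME y. y \<in> moves G r \<and> \<delta> y (target S c r) < \<delta> r (target S c r)
        else r)" for h c
  have start': "\<rho> [] c \<in> pverts G \<and> \<rho> [] c \<notin> moves G c" if "c \<in> pverts G" for c
    using someI_ex[of "\<lambda>r. r \<in> pverts G \<and> r \<notin> moves G c"] start[OF that]
    by (auto simp: \<rho>_def)
  have advance: "\<rho> h c \<in> moves G r \<and> \<delta> (\<rho> h c) (target S c r) < \<delta> r (target S c r)"
    if "h \<noteq> []" "snd (last h) = r" "snd ` set h = S" "r \<in> pverts G" "eligible S c r u" for h c r S u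
  proof -
    have "r \<in> S" using that last_in_set by blast
    then have "r \<noteq> target S c r" "target S c r \<in> pverts G"
      using target[OF that(5)] by (auto simp: eligible_def)
    then have "\<exists>y. y \<in> moves G r \<and> \<delta> y (target S c r) < \<delta> r (target S c r)"
      using step[of r "target S c r"] that(4) by blast
    from someI_ex[OF this] show ?thesis using that by (auto simp: \<rho>_def)
  qed
  have stay: "\<rho> h c = r"
    if "h \<noteq> []" "snd (last h) = r" "snd ` set h = S" "\<nexists>u. eligible S c r u" for h c r S
    using that by (auto simp: \<rho>_def)
  have \<rho>: "robber_strategy G \<rho>"
    unfolding robber_strategy_def
  proof (intro conjI ballI allI)
    fix h c r c' assume "r \<in> pverts G"
    then show "\<rho> (h @ [(c, r)]) c' \<in> moves G r"
      using advance[of "h @ [(c, r)]" r _ c'] stay[of "h @ [(c, r)]" r _ c']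
      by (cases "\<exists>u. eligible (snd ` set (h @ [(c, r)])) c' r u") (auto simp: moves_def)
  qed (use start' in blast)
  moreover have "k \<le> card (damaged \<sigma> \<rho>)" if \<sigma>: "cop_strategy G \<sigma>" for \<sigma>
  proof (rule ccontr)
    assume few: "\<not> k \<le> card (damaged \<sigma> \<rho>)"
    define c where "c = cop_at \<sigma> \<rho>"
    define r where "r = robber_at \<sigma> \<rho>"
    define S where "S t = r ` {..t}" for t
    have V: "c t \<in> pverts G" "r t \<in> pverts G" for t
      using play_in_pverts[OF \<sigma> \<rho>] by (auto simp: c_def r_def)
    have cm: "c (Suc t) \<in> moves G (c t)" for t
      using cop_at_moves[OF \<sigma> \<rho>] by (simp add: c_def)
    have visited: "snd ` set (play \<sigma> \<rho> (Suc t)) = S t" for t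
      by (simp only: play_eq_map S_def r_def set_map image_image snd_conv set_upt
          atLeast0LessThan lessThan_Suc_atMost)
    have r_Suc: "r (Suc t) = \<rho> (play \<sigma> \<rho> (Suc t)) (c (Suc t))" for t
      by (simp add: r_def c_def robber_at_Suc)
    have last_r: "snd (last (play \<sigma> \<rho> (Suc t))) = r t" for t
      by (simp only: last_play r_def snd_conv)
    have nonempty: "play \<sigma> \<rho> (Suc t) \<noteq> []" for t
      by (simp add: play_eq_map)
    define tgt where "tgt t = target (S t) (c (Suc t)) (r t)" for t
    have adv: "\<delta> (r (Suc t)) (tgt t) < \<delta> (r t) (tgt t)"
      if "eligible (S t) (c (Suc t)) (r t) u" for t u
      using advance[OF nonempty last_r visited V(2) that] by (simp add: r_Suc tgt_def)
    \<comment> \<open>A cop next to the robber would be at most one step further from the target than he is, but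
        his move has increased his lead to at least two.\<close>
    have out_of_reach: "r (Suc t) \<notin> moves G (c (Suc t))"
      if "eligible (S t) (c (Suc t)) (r t) u" for t u
    proof
      assume "r (Suc t) \<in> moves G (c (Suc t))"
      moreover have "tgt t \<in> pverts G" "\<delta> (r t) (tgt t) < \<delta> (c (Suc t)) (tgt t)"
        using target[OF that] by (auto simp: tgt_def eligible_def)
      ultimately show False
        using lip[OF V(1), of "tgt t" "r (Suc t)" "Suc t"] adv[OF that] by linarith
    qed
    \<comment> \<open>Without an eligible vertex the robber stays put, so he never walks onto the cop; hence his
        last vertex counts as damaged before it is known that he had a target.\<close>
    have self: "x \<in> pverts G \<Longrightarrow> x \<in> moves G x" for x by (simp add: moves_def)
    have step_apart: "c (Suc t) \<noteq> r t \<and> c (Suc t) \<noteq> r (Suc t)" if "r t \<notin> moves G (c t)" for t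
    proof -
      have "c (Suc t) \<noteq> r t" using cm[of t] that by auto
      moreover have "c (Suc t) \<noteq> r (Suc t)"
        using out_of_reach[of t] self[OF V(1), of "Suc t"] \<open>c (Suc t) \<noteq> r t\<close>
          stay[OF nonempty last_r visited, of t "c (Suc t)"] r_Suc[of t]
        by metis
      ultimately show ?thesis by blast
    qed
    have all_damaged: "r s \<in> damaged \<sigma> \<rho>" if "\<forall>x\<le>s. r x \<notin> moves G (c x)" for s
    proof -
      have "c x \<noteq> r x" if "x \<le> Suc s" for x
      proof (cases "x \<le> s")
        case True
        then show ?thesis
          using \<open>\<forall>x\<le>s. r x \<notin> moves G (c x)\<close> self[OF V(1), of x] by auto
      next
        case False
        then have "x = Suc s" using that by simp
        then show ?thesis
          using \<open>\<forall>x\<le>s. r x \<notin> moves G (c x)\<close> step_apart[of s] by blast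
      qed
      moreover have "c (Suc x) \<noteq> r x" if "x < Suc s" for x
        using \<open>\<forall>x\<le>s. r x \<notin> moves G (c x)\<close> that step_apart by auto
      ultimately have "\<not> captured_by \<sigma> \<rho> (Suc s)"
        unfolding captured_by_def c_def r_def by blast
      then show ?thesis unfolding damaged_def r_def by blast
    qed
    have fin_dmg: "finite (damaged \<sigma> \<rho>)"
      using V(2) by (intro finite_subset[OF _ fin]) (auto simp: damaged_def r_def)
    have ex_eligible: "\<exists>u. eligible (S t) (c (Suc t)) (r t) u"
      if "\<forall>x\<le>t. r x \<notin> moves G (c x)" for t
    proof -
      have "S t \<subseteq> damaged \<sigma> \<rho>"
        using all_damaged that by (auto simp: S_def)
      then have "card (S t) < k" using few card_mono[OF fin_dmg, of "S t"] by linarith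
      moreover have "k \<le> card {u \<in> pverts G. \<delta> (r t) u < \<delta> (c (Suc t)) u}"
        using many[OF V(1) V(2)] step_apart that by blast
      ultimately have "\<not> {u \<in> pverts G. \<delta> (r t) u < \<delta> (c (Suc t)) u} \<subseteq> S t"
        using card_mono[of "S t" "{u \<in> pverts G. \<delta> (r t) u < \<delta> (c (Suc t)) u}"]
        by (auto simp: S_def)
      then show ?thesis unfolding eligible_def by blast
    qed
    have safe: "r t \<notin> moves G (c t)" for t
    proof (induction t rule: less_induct)
      case (less t)
      show ?case
      proof (cases t)
        case 0
        then show ?thesis using start'[OF V(1), of 0] by (simp add: r_def c_def robber_at_0)
      next
        case (Suc s)
        then show ?thesis using ex_eligible[of s] less out_of_reach by auto
      qed
    qed
    \<comment> \<open>From some round on no new vertex is visited; the distance to the target then decreases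
        forever.\<close>
    have "finite (range r)"
      using V(2) by (intro finite_subset[OF _ fin]) auto
    then obtain C where C: "finite C" "range r = r ` C"
      using finite_subset_image[of "range r" r UNIV] by blast
    define T where "T = Max (insert 0 C)"
    have S: "S t = range r" if "t \<ge> T" for t
    proof -
      have "C \<subseteq> {..t}" using C(1) that by (auto simp: T_def)
      then show ?thesis using C(2) by (auto simp: S_def)
    qed
    \<comment> \<open>The cop's reply costs at most one of the lead of two, so the old target stays eligible.\<close>
    have descent: "\<delta> (r (Suc t)) (tgt (Suc t)) < \<delta> (r t) (tgt t)" if "t \<ge> T" for t
    proof -
      obtain u where u: "eligible (S t) (c (Suc t)) (r t) u" using ex_eligible safe by blast
      from target[OF u] have tg: "tgt t \<in> pverts G" "tgt t \<notin> S t"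
        "\<delta> (r t) (tgt t) < \<delta> (c (Suc t)) (tgt t)"
        by (auto simp: eligible_def tgt_def)
      have "\<delta> (c (Suc t)) (tgt t) \<le> Suc (\<delta> (c (Suc (Suc t))) (tgt t))"
        using lip[OF V(1) tg(1) cm] .
      then have "eligible (S (Suc t)) (c (Suc (Suc t))) (r (Suc t)) (tgt t)"
        using tg adv[OF u] S[of t] S[of "Suc t"] that by (auto simp: eligible_def)
      from target_le[OF this] adv[OF u] show ?thesis by (simp add: tgt_def)
    qed
    have "\<delta> (r (T + j)) (tgt (T + j)) + j \<le> \<delta> (r T) (tgt T)" for j
    proof (induction j)
      case (Suc j)
      then show ?case using descent[of "T + j"] by simp
    qed simp
    from this[of "Suc (\<delta> (r T) (tgt T))"] show False by simp
  qed
  ultimately show ?thesis unfolding robber_guarantees_def by blast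
qed


section \<open>Hamming distance\<close>

definition hamming :: "'a list \<Rightarrow> 'a list \<Rightarrow> nat" where
  "hamming x y = card {k. k < length x \<and> x ! k \<noteq> y ! k}"

abbreviation words :: "'a set \<Rightarrow> nat \<Rightarrow> 'a list set" where
  "words A d \<equiv> {xs. length xs = d \<and> set xs \<subseteq> A}"

lemma finite_words: "finite A \<Longrightarrow> finite (words A d)"
  using finite_lists_length_eq[of A d] by (simp add: conj_commute)

lemma finite_words_Collect: "finite A \<Longrightarrow> finite {x \<in> words A d. P x}"
  by (rule finite_subset[OF _ finite_words[where d = d]]) auto

lemma list_update_words: "\<lbrakk>x \<in> words A d; a \<in> A\<rbrakk> \<Longrightarrow> x[i := a] \<in> words A d"
  using set_update_subset_insert[of x i a] by auto

lemma nth_words: "\<lbrakk>x \<in> words A d; k < d\<rbrakk> \<Longrightarrow> x ! k \<in> A"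
  using nth_mem by auto

lemma hamming_triangle:
  assumes "length x = length y"
  shows "hamming x z \<le> hamming x y + hamming y z"
proof -
  have "{k. k < length x \<and> x ! k \<noteq> z ! k} \<subseteq>
      {k. k < length x \<and> x ! k \<noteq> y ! k} \<union> {k. k < length y \<and> y ! k \<noteq> z ! k}"
    using assms by auto
  then have "hamming x z \<le> card \<dots>"
    unfolding hamming_def by (intro card_mono) auto
  also have "\<dots> \<le> hamming x y + hamming y z"
    unfolding hamming_def by (rule card_Un_le)
  finally show ?thesis .
qed

lemma hamming_update:
  assumes "i < length x"
  shows "hamming (x[i := a]) y =
    card {k. k < length x \<and> k \<noteq> i \<and> x ! k \<noteq> y ! k} + (if a = y ! i then 0 else 1)"
proof -
  have "{k. k < length (x[i := a]) \<and> x[i := a] ! k \<noteq> y ! k} =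
      (if a = y ! i then {} else {i}) \<union> {k. k < length x \<and> k \<noteq> i \<and> x ! k \<noteq> y ! k}"
    using assms by (auto simp: nth_list_update split: if_splits)
  then show ?thesis by (simp add: hamming_def card_insert_if)
qed

lemma card_hyperplane:
  assumes "finite A" and "i < d" and "a \<in> A"
  shows "card {x \<in> words A d. x ! i = a} = card A ^ (d - 1)"
proof -
  have "bij_betw (\<lambda>x. take i x @ a # drop i x) (words A (d - 1)) {x \<in> words A d. x ! i = a}"
  proof (rule bij_betw_byWitness[where f' = "\<lambda>x. take i x @ drop (Suc i) x"])
    show "(\<lambda>x. take i x @ a # drop i x) ` words A (d - 1) \<subseteq> {x \<in> words A d. x ! i = a}"
      using assms by (auto simp: nth_append dest!: in_set_takeD in_set_dropD)
    show "(\<lambda>x. take i x @ drop (Suc i) x) ` {x \<in> words A d. x ! i = a} \<subseteq> words A (d - 1)"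
      using assms by (auto dest!: in_set_takeD in_set_dropD)
  qed (use assms in \<open>auto simp: min_def id_take_nth_drop[symmetric] Suc_diff_le\<close>)
  then have "card {x \<in> words A d. x ! i = a} = card (words A (d - 1))"
    by (simp add: bij_betw_same_card)
  also have "\<dots> = card A ^ (d - 1)"
    using card_lists_length_eq[OF assms(1), of "d - 1"] by (simp add: conj_commute)
  finally show ?thesis .
qed

text \<open>
  Off coordinate \<open>i\<close>, let the line have distances \<open>p\<close> and \<open>q\<close> to \<open>r\<close> and \<open>c\<close>.  The letters
  \<open>r ! i\<close>, \<open>c ! i\<close> and any third one give the pairs of distances \<open>(p, q + 1)\<close>, \<open>(p + 1, q)\<close> and
  \<open>(p + 1, q + 1)\<close>, at most one of which can be a tie.
\<close>

lemma two_unequal_on_line: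
  assumes "finite A" and "card A \<ge> 3" and "i < d"
    and "r \<in> words A d" and "c \<in> words A d" and "r ! i \<noteq> c ! i" and "u \<in> words A d"
  shows "2 \<le> card {a \<in> A. hamming (u[i := a]) r \<noteq> hamming (u[i := a]) c}"
    (is "2 \<le> card ?N")
proof -
  have rc: "r ! i \<in> A" "c ! i \<in> A" using assms nth_words by blast+
  have "\<not> A \<subseteq> {r ! i, c ! i}"
    using assms(2) card_mono[of "{r ! i, c ! i}" A] card_insert_le_m1[of 2 "{c ! i}" "r ! i"]
    by fastforce
  then obtain z where z: "z \<in> A" "z \<noteq> r ! i" "z \<noteq> c ! i" by blast
  define p where "p = card {k. k < length u \<and> k \<noteq> i \<and> u ! k \<noteq> r ! k}"
  define q where "q = card {k. k < length u \<and> k \<noteq> i \<and> u ! k \<noteq> c ! k}"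
  have h: "hamming (u[i := a]) r = p + (if a = r ! i then 0 else 1)"
    "hamming (u[i := a]) c = q + (if a = c ! i then 0 else 1)" for a
    using assms(3,7) by (simp_all add: hamming_update p_def q_def)
  have "\<exists>a b. a \<noteq> b \<and> {a, b} \<subseteq> ?N"
  proof (cases "p = q")
    case True
    then show ?thesis using rc assms(6)
      by (intro exI[of _ "r ! i"] exI[of _ "c ! i"]) (auto simp: h)
  next
    case False
    show ?thesis
    proof (cases "p = Suc q")
      case True
      then show ?thesis using rc z assms(6)
        by (intro exI[of _ "c ! i"] exI[of _ z]) (auto simp: h)
    next
      case nSuc: False
      then show ?thesis using rc z assms(6) False
        by (intro exI[of _ "r ! i"] exI[of _ z]) (auto simp: h)
    qed
  qed
  then obtain a b where ab: "a \<noteq> b" "{a, b} \<subseteq> ?N" by blast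
  have "finite ?N" using assms(1) by simp
  from card_mono[OF this ab(2)] ab(1) show ?thesis by simp
qed

lemma card_unequal_ge:
  assumes "finite A" and "card A \<ge> 3"
    and "r \<in> words A d" and "c \<in> words A d" and "r \<noteq> c"
  shows "2 * card A ^ (d - 1) \<le> card {u \<in> words A d. hamming u r \<noteq> hamming u c}"
proof -
  obtain i where i: "i < d" "r ! i \<noteq> c ! i"
    using assms(3-5) by (auto simp: list_eq_iff_nth_eq)
  define B where "B = {u \<in> words A d. u ! i = r ! i}"
  define L where "L u = (\<lambda>a. u[i := a]) ` {a \<in> A. hamming (u[i := a]) r \<noteq> hamming (u[i := a]) c}"
    for u
  have finB: "finite B" unfolding B_def using assms(1) by (rule finite_words_Collect)
  have finL: "finite (L u)" for u using assms(1) by (simp add: L_def)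
  have two: "2 \<le> card (L u)" if "u \<in> B" for u
  proof -
    have "inj_on (\<lambda>a. u[i := a]) X" for X
      using that i(1) by (intro inj_onI) (auto simp: B_def dest: arg_cong[where f = "\<lambda>x. x ! i"])
    then show ?thesis
      using two_unequal_on_line[OF assms(1,2) i(1) assms(3,4) i(2), of u] that
      by (auto simp: L_def B_def card_image)
  qed
  \<comment> \<open>A point of the hyperplane is recovered from any point of its line by resetting coordinate
      \<open>i\<close>.\<close>
  have recover: "v[i := r ! i] = u" if "u \<in> B" "v \<in> L u" for u v
    using that i(1) by (auto simp: B_def L_def) (metis list_update_id)
  have disj: "L u \<inter> L v = {}" if "u \<in> B" "v \<in> B" "u \<noteq> v" for u v
    using recover that by blast
  have "2 * card A ^ (d - 1) = 2 * card B"
    using card_hyperplane[OF assms(1) i(1) nth_words[OF assms(3) i(1)]] by (simp add: B_def)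
  also have "\<dots> \<le> (\<Sum>u\<in>B. card (L u))"
    using sum_mono[of B "\<lambda>_. 2" "\<lambda>u. card (L u)"] two by simp
  also have "\<dots> = card (\<Union>u\<in>B. L u)"
    using finB finL disj by (intro card_UN_disjoint[symmetric]) auto
  also have "\<dots> \<le> card {u \<in> words A d. hamming u r \<noteq> hamming u c}"
  proof (rule card_mono)
    show "finite {u \<in> words A d. hamming u r \<noteq> hamming u c}"
      using assms(1) by (rule finite_words_Collect)
    show "(\<Union>u\<in>B. L u) \<subseteq> {u \<in> words A d. hamming u r \<noteq> hamming u c}"
      using list_update_words[of _ d A _ i] by (fastforce simp: B_def L_def)
  qed
  finally show ?thesis .
qed

definition swap_words :: "'a list \<Rightarrow> 'a list \<Rightarrow> 'a list \<Rightarrow> 'a list" where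
  "swap_words r c u = map (\<lambda>k. transpose (r ! k) (c ! k) (u ! k)) [0..<length u]"

lemma swap_words_involutory: "swap_words r c (swap_words r c u) = u"
  by (rule nth_equalityI) (simp_all add: swap_words_def)

lemma swap_words_words:
  assumes "r \<in> words A d" and "c \<in> words A d" and "u \<in> words A d"
  shows "swap_words r c u \<in> words A d"
  using assms nth_words[of _ d A] by (auto simp: swap_words_def transpose_def)

lemma hamming_swap_words:
  shows "hamming (swap_words r c u) r = hamming u c"
    and "hamming (swap_words r c u) c = hamming u r"
  unfolding hamming_def swap_words_def
  by (auto intro!: arg_cong[where f = card] simp: transpose_eq_iff transpose_def split: if_splits)

lemma card_closer_ge:
  assumes "finite A" and "card A \<ge> 3"
    and "r \<in> words A d" and "c \<in> words A d" and "r \<noteq> c"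
  shows "card A ^ (d - 1) \<le> card {u \<in> words A d. hamming u r < hamming u c}"
    (is "_ \<le> card ?R")
proof -
  let ?C = "{u \<in> words A d. hamming u c < hamming u r}"
  have fin: "finite ?R" "finite ?C" by (rule finite_words_Collect[OF assms(1)])+
  have "card ?C \<le> card ?R"
  proof (rule card_inj_on_le)
    show "inj_on (swap_words r c) ?C"
      by (rule inj_on_inverseI[where g = "swap_words r c"]) (rule swap_words_involutory)
    show "swap_words r c ` ?C \<subseteq> ?R"
      using swap_words_words[OF assms(3,4)] by (force simp: hamming_swap_words)
  qed (rule fin)
  moreover have "{u \<in> words A d. hamming u r \<noteq> hamming u c} = ?R \<union> ?C" by auto
  then have "2 * card A ^ (d - 1) \<le> card ?R + card ?C"
    using card_unequal_ge[OF assms] card_Un_le[of ?R ?C] by simp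
  ultimately show ?thesis by linarith
qed


section \<open>Powers of complete graphs\<close>

lemma moves_cart_power_complete:
  assumes K: "complete_digraph n (with_proj K)" and x: "x \<in> pverts (cart_power K d)"
  shows "y \<in> moves (cart_power K d) x \<longleftrightarrow>
    y \<in> pverts (cart_power K d) \<and> hamming x y \<le> 1"
proof (cases "y \<in> pverts (cart_power K d)")
  case True
  have len: "length x = d" "length y = d" using x True by (auto simp: pverts_cart_power)
  have "hamming x y = 0 \<longleftrightarrow> x = y"
    using len by (auto simp: hamming_def list_eq_iff_nth_eq)
  moreover have "hamming x y = 1 \<longleftrightarrow> (\<exists>!i. i < d \<and> x ! i \<noteq> y ! i)"
  proof -
    have "card {i. P i} = 1 \<longleftrightarrow> (\<exists>!i. P i)" for P :: "nat \<Rightarrow> bool"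
      unfolding One_nat_def card_1_singleton_iff set_eq_iff mem_Collect_eq singleton_iff by metis
    then show ?thesis using len by (simp add: hamming_def)
  qed
  ultimately show ?thesis
    using True cart_power_complete_adj[OF K x True] by (auto simp: moves_def le_Suc_eq)
qed (simp add: moves_def)

lemma robber_guarantees_cart_power_complete:
  assumes K: "complete_digraph n (with_proj K)" and n: "n \<ge> 3" and d: "d \<ge> 2"
  shows "robber_guarantees (cart_power K d) (n ^ (d - 1))"
proof -
  let ?A = "pverts K"
  have A: "finite ?A" "card ?A = n" using K by (auto simp: complete_digraph_pair_def)
  note mv = moves_cart_power_complete[OF K, unfolded pverts_cart_power]
  show ?thesis
  proof (rule robber_guarantees_if_many_closer[where \<delta> = "\<lambda>x u. hamming u x"],
      unfold pverts_cart_power)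
    show "finite (words ?A d)" using A finite_words by blast
  next
    fix x y u assume *: "x \<in> words ?A d" "u \<in> words ?A d" "y \<in> moves (cart_power K d) x"
    have "hamming y x = hamming x y"
      using * mv unfolding hamming_def by (intro arg_cong[where f = card]) auto
    then show "hamming u x \<le> Suc (hamming u y)"
      using hamming_triangle[of u y x] * mv by auto
  next
    fix x u assume *: "x \<in> words ?A d" "u \<in> words ?A d" "x \<noteq> u"
    then obtain i where i: "i < d" "x ! i \<noteq> u ! i" by (auto simp: list_eq_iff_nth_eq)
    let ?y = "x[i := u ! i]"
    have "hamming x ?y \<le> card {i}"
      unfolding hamming_def by (intro card_mono) (auto, metis nth_list_update_neq)
    then have "?y \<in> moves (cart_power K d) x"
      using mv[OF *(1)] list_update_words[OF *(1) nth_words[OF *(2) i(1)]] by simp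
    moreover have "hamming u ?y < hamming u x"
      unfolding hamming_def
      using i * by (intro psubset_card_mono) (auto simp: nth_list_update split: if_splits)
    ultimately show "\<exists>y\<in>moves (cart_power K d) x. hamming u y < hamming u x" by blast
  next
    fix c assume c: "c \<in> words ?A d"
    have "\<exists>b\<in>?A. b \<noteq> a" for a
    proof -
      have "\<not> ?A \<subseteq> {a}" using A n card_mono[of "{a}" ?A] by fastforce
      then show ?thesis by blast
    qed
    then obtain f where f: "f a \<in> ?A" "f a \<noteq> a" for a by metis
    have "{k. k < length c \<and> c ! k \<noteq> map f c ! k} = {..<d}"
      using c f by (auto simp: eq_commute)
    then have "hamming c (map f c) = d" by (simp add: hamming_def)
    moreover have "map f c \<in> words ?A d" using c f by auto
    ultimately show "\<exists>r\<in>words ?A d. r \<notin> moves (cart_power K d) c"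
      using mv[OF c] d by (intro bexI[of _ "map f c"]) auto
  next
    fix c r assume "c \<in> words ?A d" "r \<in> words ?A d" "c \<noteq> r"
    then show "n ^ (d - 1) \<le> card {u \<in> words ?A d. hamming u r < hamming u c}"
      using card_closer_ge[of ?A r d c] A n by simp
  qed
qed

text \<open>
  After round \<open>t\<close> the history has length \<open>t + 1\<close>, so the index \<open>length h - 2\<close> addresses the
  previous round; after round \<open>0\<close> it is truncated to \<open>0\<close> and the robber counts as not having
  moved.  The membership test makes the strategy legal on histories that no play produces.
\<close>

definition mirror :: "'a list pair_pre_digraph \<Rightarrow> 'a list \<Rightarrow> 'a list history \<Rightarrow> 'a list" where
  "mirror G v h =
     (if h = [] then v
      else let (c, r) = last h; p = snd (h ! (length h - 2));
               c' = map (\<lambda>k. if r ! k \<noteq> p ! k then r ! k else c ! k) [0..<length c]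
           in if c' \<in> moves G c then c' else c)"

lemma cop_strategy_mirror: "v \<in> pverts G \<Longrightarrow> cop_strategy G (mirror G v)"
  by (auto simp: cop_strategy_def mirror_def Let_def moves_def)

lemma cop_at_mirror_Suc:
  fixes K :: "'a pair_pre_digraph" and d :: nat
  defines "G \<equiv> cart_power K d"
  assumes K: "complete_digraph n (with_proj K)"
    and v: "v \<in> pverts G" and \<rho>: "robber_strategy G \<rho>" and k: "k < d"
  shows "cop_at (mirror G v) \<rho> (Suc t) ! k =
    (if robber_at (mirror G v) \<rho> t ! k \<noteq> robber_at (mirror G v) \<rho> (t - 1) ! k
     then robber_at (mirror G v) \<rho> t ! k else cop_at (mirror G v) \<rho> t ! k)"
proof -
  define c where "c = cop_at (mirror G v) \<rho>"
  define r where "r = robber_at (mirror G v) \<rho>"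
  note \<sigma> = cop_strategy_mirror[OF v]
  have V: "c t \<in> words (pverts K) d" "r t \<in> words (pverts K) d" for t
    using play_in_pverts[OF \<sigma> \<rho>] unfolding c_def r_def G_def pverts_cart_power by blast+
  define w where "w = map (\<lambda>k. if r t ! k \<noteq> r (t - 1) ! k then r t ! k else c t ! k) [0..<d]"
  have "snd (play (mirror G v) \<rho> (Suc t) ! (Suc t - 2)) = r (t - 1)"
    unfolding play_eq_map r_def by (simp add: less_Suc_eq_le del: upt_Suc)
  then have eq: "c (Suc t) = (if w \<in> moves G (c t) then w else c t)"
    using V(1)[of t] last_play[of "mirror G v" \<rho> t]
    unfolding w_def c_def r_def
    by (simp add: cop_at_Suc mirror_def Let_def play_eq_map del: upt_Suc play.simps)
  have "hamming (r (t - 1)) (r t) \<le> 1"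
  proof (cases t)
    case 0
    then show ?thesis by (simp add: hamming_def)
  next
    case (Suc s)
    then show ?thesis
      using robber_at_moves[OF \<sigma> \<rho>, of s] V(2)[of s]
        moves_cart_power_complete[OF K, of "r s" d "r (Suc s)"]
      by (simp add: G_def r_def pverts_cart_power)
  qed
  moreover have "hamming (c t) w \<le> hamming (r (t - 1)) (r t)"
    unfolding hamming_def using V by (intro card_mono) (auto simp: w_def)
  moreover have "w \<in> words (pverts K) d"
    using nth_words[OF V(1)] nth_words[OF V(2)] by (auto simp: w_def)
  ultimately have "w \<in> moves G (c t)"
    using moves_cart_power_complete[OF K, of "c t" d w] V(1)[of t]
    by (simp add: G_def pverts_cart_power)
  then show ?thesis using eq k by (simp add: c_def r_def w_def)
qed

text \<open>
  If no coordinate worked for all damaged vertices, then at some time at which damage still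
  occurs the robber would have changed every coordinate, so that the mirroring cop agrees with
  him everywhere: he is captured, a contradiction.
\<close>

lemma damaged_mirror_subset_hyperplane:
  fixes K :: "'a pair_pre_digraph" and d :: nat
  defines "G \<equiv> cart_power K d"
  assumes K: "complete_digraph n (with_proj K)"
    and v: "v \<in> pverts G" and \<rho>: "robber_strategy G \<rho>" and d: "d > 0"
  shows "\<exists>k<d. \<exists>a\<in>pverts K. damaged (mirror G v) \<rho> \<subseteq> {x \<in> pverts G. x ! k = a}"
proof -
  define c where "c = cop_at (mirror G v) \<rho>"
  define r where "r = robber_at (mirror G v) \<rho>"
  note \<sigma> = cop_strategy_mirror[OF v]
  have V: "c t \<in> pverts G" "r t \<in> pverts G" for t
    using play_in_pverts[OF \<sigma> \<rho>] unfolding c_def r_def by blast+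
  have c_Suc: "c (Suc t) ! k = (if r t ! k \<noteq> r (t - 1) ! k then r t ! k else c t ! k)"
    if "k < d" for t k
    using cop_at_mirror_Suc[OF K v[unfolded G_def] \<rho>[unfolded G_def] that]
    by (simp add: c_def r_def G_def)
  have agree: "c (Suc t) ! k = r t ! k \<or> (\<forall>s\<le>t. r s ! k = r 0 ! k)" if "k < d" for t k
  proof (induction t)
    case (Suc t)
    then show ?case using c_Suc[OF that, of "Suc t"] by (auto simp: le_Suc_eq)
  qed simp
  have unchanged: "\<exists>k<d. \<forall>s\<le>t. r s ! k = r 0 ! k"
    if "\<not> captured_by (mirror G v) \<rho> (Suc t)" for t
  proof -
    have "c (Suc t) \<noteq> r t" using that unfolding captured_by_def c_def r_def by blast
    then obtain k where "k < d" "c (Suc t) ! k \<noteq> r t ! k"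
      using V[of t] V(1)[of "Suc t"] unfolding G_def pverts_cart_power
      by (auto simp: list_eq_iff_nth_eq)
    then show ?thesis using agree by blast
  qed
  have "\<exists>k<d. \<forall>t. \<not> captured_by (mirror G v) \<rho> (Suc t) \<longrightarrow> r t ! k = r 0 ! k"
  proof (rule ccontr)
    assume "\<not> ?thesis"
    then have "\<forall>k\<in>{..<d}. \<exists>t. \<not> captured_by (mirror G v) \<rho> (Suc t) \<and> r t ! k \<noteq> r 0 ! k"
      by blast
    then obtain f where f: "\<not> captured_by (mirror G v) \<rho> (Suc (f k))" "r (f k) ! k \<noteq> r 0 ! k"
      if "k < d" for k
      by (metis lessThan_iff)
    define T where "T = Max (f ` {..<d})"
    have "T \<in> f ` {..<d}" unfolding T_def using d by (intro Max_in) auto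
    then obtain k where k: "k < d" "\<forall>s\<le>T. r s ! k = r 0 ! k" using f(1) unchanged by blast
    moreover have "f k \<le> T" unfolding T_def using k(1) by (intro Max_ge) auto
    ultimately show False using f(2) by blast
  qed
  then obtain k where k: "k < d"
    "\<And>t. \<not> captured_by (mirror G v) \<rho> (Suc t) \<Longrightarrow> r t ! k = r 0 ! k"
    by blast
  then have "damaged (mirror G v) \<rho> \<subseteq> {x \<in> pverts G. x ! k = r 0 ! k}"
    using V(2) by (auto simp: damaged_def r_def)
  moreover have "r 0 ! k \<in> pverts K"
    using V(2)[of 0] k(1) nth_words[of "r 0" d "pverts K" k] by (simp add: G_def pverts_cart_power)
  ultimately show ?thesis using k(1) by blast
qed

theorem corollary1p1:
  fixes n d :: nat and K :: "'a pair_pre_digraph"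
  assumes "n \<ge> 3" and "d \<ge> 2"
    and "complete_digraph n (with_proj K)"
  shows "dmg (cart_power K d) = n ^ (d - 1)"
proof -
  let ?G = "cart_power K d"
  have A: "finite (pverts K)" "card (pverts K) = n"
    using assms(3) by (auto simp: complete_digraph_pair_def)
  have fin: "finite (pverts ?G)"
    using finite_words[OF A(1)] by (simp add: pverts_cart_power)
  obtain a where "a \<in> pverts K" using A assms(1) by fastforce
  then have v: "replicate d a \<in> pverts ?G" by (auto simp: pverts_cart_power)
  have "k \<le> n ^ (d - 1)" if guar: "robber_guarantees ?G k" for k
  proof -
    let ?\<sigma> = "mirror ?G (replicate d a)"
    obtain \<rho> where \<rho>: "robber_strategy ?G \<rho>" and k: "k \<le> card (damaged ?\<sigma> \<rho>)"
      using guar cop_strategy_mirror[OF v] unfolding robber_guarantees_def by blast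
    obtain i b where i: "i < d" "b \<in> pverts K"
      and sub: "damaged ?\<sigma> \<rho> \<subseteq> {x \<in> pverts ?G. x ! i = b}"
      using damaged_mirror_subset_hyperplane[OF assms(3) v \<rho>] assms(2) by auto
    have "card (damaged ?\<sigma> \<rho>) \<le> card {x \<in> pverts ?G. x ! i = b}"
      using fin sub by (intro card_mono) auto
    then show ?thesis
      using k card_hyperplane[OF A(1) i] A(2) by (simp add: pverts_cart_power)
  qed
  moreover have "finite {k. robber_guarantees ?G k}"
    using dmg_set(2) fin v by blast
  ultimately show ?thesis
    unfolding dmg_def using robber_guarantees_cart_power_complete[OF assms(3,1,2)]
    by (intro Max_eqI) auto
qed

end
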